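(* Let $t \geq 128$ be a rational integer. Put \[ \epsilon = \frac{t+\sqrt{t^{2}+16}}{4}, \quad \rho = \sqrt{1+\epsilon^{2}}, \] \[ \beta^{(0)} = \epsilon-\rho, \quad \beta^{(1)} = \frac{\rho-1}{\epsilon}, \quad \beta^{(2)} = \rho+\epsilon, \quad \beta^{(3)} = -\frac{\rho+1}{\epsilon} \] (these are the four roots of $X^{4}-tX^{3}-6X^{2}+tX+1$), and define \[ \kappa = \frac{\log (8\epsilon)}{\log (\epsilon/8)}. \] Then for $j=0,1,2,3$ and any rational integers $p$ and $q$ with $|q| > 0.16t$, we have \[ \left| p - \beta^{(j)} q \right| > \frac{1}{c_{j}|q|^{\kappa}}, \] where $c_{0} = c_{1} = c_{3} = 11.33\,t \cdot 0.4^{\kappa}$ and $c_{2} = 8.01\,t\,(0.4t)^{\kappa}$. *)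

theory Defs
  imports Complex_Main
begin

definition eps :: "int \<Rightarrow> real" where
  "eps t = (real_of_int t + sqrt (real_of_int t ^ 2 + 16)) / 4"

definition rho :: "int \<Rightarrow> real" where
  "rho t = sqrt (1 + eps t ^ 2)"

definition beta :: "int \<Rightarrow> nat \<Rightarrow> real" where
  "beta t j = (if j = 0 then eps t - rho t
               else if j = 1 then (rho t - 1) / eps t
               else if j = 2 then rho t + eps t
               else - (rho t + 1) / eps t)"

definition kappa :: "int \<Rightarrow> real" where
  "kappa t = ln (8 * eps t) / ln (eps t / 8)"

definition cconst :: "int \<Rightarrow> nat \<Rightarrow> real" where
  "cconst t j = (if j = 2 then 8.01 * real_of_int t * (0.4 * real_of_int t) powr kappa t
                 else 11.33 * real_of_int t * 0.4 powr kappa t)"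

end

theory Submission
  imports Defs
begin

text \<open>
  With \<open>\<tau> = \<rho> - \<epsilon> = tan (arctan (4 / t) / 4)\<close> the four roots are \<open>-\<tau>\<close>, \<open>(1 - \<tau>) / (1 + \<tau>)\<close>,
  \<open>1 / \<tau>\<close> and \<open>-(1 + \<tau>) / (1 - \<tau>)\<close>, so good rational approximations of \<open>\<tau>\<close> serve all of them.
  The continued fraction of \<open>tan (\<nu> arctan z)\<close> at \<open>\<nu> = 1/4\<close>, \<open>z = 4 / t\<close> has convergents
  \<open>Q\<^sub>r / P\<^sub>r\<close>, where both sequences satisfy
  \<open>X\<^sub>r\<^sub>+\<^sub>1 = (2 r + 1) t X\<^sub>r + (16 r\<^sup>2 - 1) X\<^sub>r\<^sub>-\<^sub>1\<close>. The numbers \<open>2\<^sup>r X\<^sub>r / r!\<close> are integers, because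
  \<open>P\<^sub>r + i Q\<^sub>r\<close> is a Pade polynomial of \<open>(1 - z) powr (1/4)\<close> whose denominators are cancelled by
  \<open>(t + 4 i) - (t - 4 i) = 8 i\<close>. As \<open>l = 4 \<epsilon>\<close> solves \<open>l\<^sup>2 = 2 t l + 16\<close>, the integers grow at
  most like \<open>(8 \<epsilon>)\<^sup>r\<close>, while the errors \<open>Q\<^sub>r - \<tau> P\<^sub>r\<close> alternate in sign and so, by the
  determinant formula, decay like \<open>(8 / \<epsilon>)\<^sup>r\<close>. Hence the exponent
  \<open>\<kappa> = ln (8 \<epsilon>) / ln (\<epsilon> / 8)\<close>.
\<close>

section \<open>Divisibility by factorials\<close>

lemma odd_part_fact: "\<exists>e m. e \<le> k \<and> odd m \<and> (fact k :: int) = 2 ^ e * m"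
proof (induction k rule: less_induct)
  case (less k)
  show ?case
  proof (cases "k = 0")
    case True
    then show ?thesis by (intro exI[of _ 0] exI[of _ 1]) simp
  next
    case False
    have odd_fact: "\<exists>m. odd m \<and> (fact (2 * n) :: int) = 2 ^ n * fact n * m" for n
    proof (induction n)
      case 0
      show ?case by (intro exI[of _ 1]) simp
    next
      case (Suc n)
      then obtain m where "odd m" "(fact (2 * n) :: int) = 2 ^ n * fact n * m" by blast
      then show ?case by (intro exI[of _ "(2 * int n + 1) * m"]) (simp add: algebra_simps)
    qed
    define n where "n = k div 2"
    obtain m where m: "odd m" "(fact (2 * n) :: int) = 2 ^ n * fact n * m"
      using odd_fact by blast
    have "n < k" using False n_def by auto
    then obtain e m' where em: "e \<le> n" "odd m'" "(fact n :: int) = 2 ^ e * m'"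
      using less.IH by blast
    show ?thesis
    proof (cases "even k")
      case True
      then have k: "k = 2 * n" unfolding n_def by simp
      show ?thesis
        using m em unfolding k
        by (intro exI[of _ "n + e"] exI[of _ "m * m'"]) (auto simp: power_add)
    next
      case False
      then have k: "k = Suc (2 * n)" unfolding n_def by simp
      show ?thesis
        using m em unfolding k
        by (intro exI[of _ "n + e"] exI[of _ "(2 * int n + 1) * (m * m')"]) (auto simp: power_add)
    qed
  qed
qed

lemma dvd_prod_diff:
  fixes m :: int
  assumes "\<And>i. i \<in> I \<Longrightarrow> m dvd f i - g i"
  shows "m dvd (\<Prod>i\<in>I. f i) - (\<Prod>i\<in>I. g i)"
  using assms
proof (induction I rule: infinite_finite_induct)
  case (insert x I)
  have "(\<Prod>i\<in>insert x I. f i) - (\<Prod>i\<in>insert x I. g i) =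
     f x * ((\<Prod>i\<in>I. f i) - (\<Prod>i\<in>I. g i)) + (f x - g x) * (\<Prod>i\<in>I. g i)"
    using insert.hyps by (simp add: algebra_simps)
  then show ?case using insert by simp
qed auto

lemma fact_dvd_falling_prod: "fact k dvd (\<Prod>i = 0..<k. a - int i)"
proof -
  have "(\<Prod>i = 0..<k. a - int i) = (-1) ^ k * pochhammer (- a) k"
    by (simp add: falling_fact_pochhammer)
  then show ?thesis using fact_dvd_pochhammer[of k "- a"] by simp
qed

lemma fact_dvd_quarter_prod: "fact k dvd 2 ^ k * (\<Prod>i = 0..<k. a - 4 * int i)"
proof -
  \<comment> \<open>Modulo the odd part \<open>m\<close> of \<open>fact k\<close> the step \<open>4\<close> is invertible, which reduces to a falling factorial;
    the remaining power of two divides \<open>2 ^ k\<close>.\<close>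
  obtain e m where em: "e \<le> k" "odd m" "(fact k :: int) = 2 ^ e * m"
    using odd_part_fact by blast
  have "coprime 4 m" using em(2) coprime_power_left_iff[of "2::int" 2 m] by simp
  then obtain u v where "u * 4 + v * m = 1" using bezout_int[of 4 m] by auto
  then have uv: "u * 4 = 1 - v * m" by simp
  have "m dvd (\<Prod>i = 0..<k. a - 4 * int i) - (\<Prod>i = 0..<k. 4 * (a * u - int i))"
  proof (rule dvd_prod_diff)
    fix i
    have "a - 4 * int i - 4 * (a * u - int i) = m * (a * v)" using uv by algebra
    then show "m dvd a - 4 * int i - 4 * (a * u - int i)" by simp
  qed
  moreover have "m dvd (\<Prod>i = 0..<k. 4 * (a * u - int i))"
    using fact_dvd_falling_prod[of k "a * u"] em(3) unfolding prod.distrib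
    by (metis dvd_mult dvd_mult_right)
  ultimately have "m dvd (\<Prod>i = 0..<k. a - 4 * int i)" by (simp add: dvd_diff_left_iff)
  moreover have "2 ^ e dvd (2 ^ k :: int)" using em(1) by (rule le_imp_power_dvd)
  ultimately show ?thesis unfolding em(3) by (simp add: mult_dvd_mono)
qed

lemma gbinomial_quarter_Ints:
  "8 ^ k * ((of_nat n + 1 / 4) gchoose k) \<in> (\<int> :: 'a::field_char_0 set)"
proof -
  define z where "z = 2 ^ k * (\<Prod>i = 0..<k. (4 * int n + 1) - 4 * int i)"
  obtain w where w: "z = fact k * w" using fact_dvd_quarter_prod unfolding z_def by blast
  have "of_int z = 2 ^ k * (\<Prod>i = 0..<k. 4 * ((of_nat n + 1 / 4) - of_nat i) :: 'a)"
    unfolding z_def by (simp add: algebra_simps)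
  also have "\<dots> = 2 ^ k * 4 ^ k * (\<Prod>i = 0..<k. (of_nat n + 1 / 4) - of_nat i)"
    unfolding prod.distrib by simp
  also have "\<dots> = 8 ^ k * (fact k * ((of_nat n + 1 / 4) gchoose k))"
    unfolding gbinomial_mult_fact power_mult_distrib[symmetric] by simp
  finally have "fact k * (8 ^ k * ((of_nat n + 1 / 4) gchoose k)) = (fact k * of_int w :: 'a)"
    unfolding w by (simp add: mult_ac)
  then have "8 ^ k * ((of_nat n + 1 / 4) gchoose k) = (of_int w :: 'a)" by simp
  then show ?thesis by simp
qed

section \<open>The Pade sums and their recurrence\<close>

text \<open>Up to the factor \<open>(2 r) choose r\<close>, \<open>pade_sum \<mu> (x - y) y r\<close> is the homogenisation of
  \<open>F(-r, -r - \<mu>; -2 r; 1 - z)\<close> at \<open>z = x / y\<close>. The truncated subtraction in \<open>pade_coeff\<close> is harmless for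
  \<open>r > 0\<close>: the coefficient vanishes for all \<open>k > r\<close>.\<close>

definition pade_coeff :: "'a::field_char_0 \<Rightarrow> nat \<Rightarrow> nat \<Rightarrow> 'a" where
  "pade_coeff \<mu> r k = of_nat ((2 * r - k) choose r) * ((of_nat r + \<mu>) gchoose k)"

definition pade_sum :: "'a::field_char_0 \<Rightarrow> 'a \<Rightarrow> 'a \<Rightarrow> nat \<Rightarrow> 'a" where
  "pade_sum \<mu> d y r = (\<Sum>k\<le>r. pade_coeff \<mu> r k * d ^ k * y ^ (r - k))"

lemma pade_coeff_eq_0: "k > r \<Longrightarrow> r > 0 \<Longrightarrow> pade_coeff \<mu> r k = 0"
  unfolding pade_coeff_def by (simp add: binomial_eq_0)

lemma pade_coeff_diag:
  "of_nat ((k + m + 1) * (k + 1)) * pade_coeff \<mu> (k + m + 1) (k + 1) =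
     (of_nat (k + m + 1) + \<mu>) * of_nat (k + 2 * m + 1) * pade_coeff \<mu> (k + m) k"
proof -
  have 1: "of_nat (k + 1) * ((of_nat (k + m + 1) + \<mu>) gchoose (k + 1)) =
        (of_nat (k + m + 1) + \<mu>) * ((of_nat (k + m) + \<mu>) gchoose k)"
    using gbinomial_absorption[of k "of_nat (k + m + 1) + \<mu>"] by (simp add: algebra_simps)
  have "(k + m + 1) * (Suc (k + 2 * m) choose Suc (k + m)) = (k + 2 * m + 1) * ((k + 2 * m) choose (k + m))"
    using Suc_times_binomial[of "k + m" "k + 2 * m"] by simp
  then have 2: "of_nat (k + m + 1) * of_nat (Suc (k + 2 * m) choose Suc (k + m)) =
     (of_nat (k + 2 * m + 1) * of_nat ((k + 2 * m) choose (k + m)) :: 'a)"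
    by (metis of_nat_mult)
  have idx: "2 * (k + m + 1) - (k + 1) = Suc (k + 2 * m)" "2 * (k + m) - k = k + 2 * m"
    "k + m + 1 = Suc (k + m)" by auto
  have "of_nat ((k + m + 1) * (k + 1)) * pade_coeff \<mu> (k + m + 1) (k + 1) =
     (of_nat (k + m + 1) * of_nat (Suc (k + 2 * m) choose Suc (k + m))) *
     (of_nat (k + 1) * ((of_nat (k + m + 1) + \<mu>) gchoose (k + 1)))"
    unfolding pade_coeff_def idx(1) idx(3)[symmetric] of_nat_mult by (simp only: mult_ac idx(3))
  also have "\<dots> = (of_nat (k + m + 1) + \<mu>) * of_nat (k + 2 * m + 1) * pade_coeff \<mu> (k + m) k"
    unfolding 1 2 pade_coeff_def idx(2) by (simp only: mult_ac)
  finally show ?thesis .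
qed

lemma pade_coeff_horiz:
  "of_nat ((k + 2) * (k + 2 * m + 1)) * pade_coeff \<mu> (k + m + 1) (k + 2) =
     (of_nat m + \<mu>) * of_nat m * pade_coeff \<mu> (k + m + 1) (k + 1)"
proof -
  have 1: "of_nat (k + 2) * ((of_nat (k + m + 1) + \<mu>) gchoose (k + 2)) =
        (of_nat m + \<mu>) * ((of_nat (k + m + 1) + \<mu>) gchoose (k + 1))"
    using gbinomial_mult_1[of "of_nat (k + m + 1) + \<mu>" "k + 1"] by (simp add: algebra_simps)
  have "(k + 2 * m + 1) * ((k + 2 * m) choose (k + m + 1)) = m * ((k + 2 * m + 1) choose (k + m + 1))"
    using binomial_absorb_comp[of "k + 2 * m + 1" "k + m + 1"] by simp
  then have 2: "of_nat (k + 2 * m + 1) * of_nat ((k + 2 * m) choose (k + m + 1)) =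
     (of_nat m * of_nat ((k + 2 * m + 1) choose (k + m + 1)) :: 'a)"
    by (metis of_nat_mult)
  have idx: "2 * (k + m + 1) - (k + 2) = k + 2 * m" "2 * (k + m + 1) - (k + 1) = k + 2 * m + 1" by auto
  have "of_nat ((k + 2) * (k + 2 * m + 1)) * pade_coeff \<mu> (k + m + 1) (k + 2) =
     (of_nat (k + 2 * m + 1) * of_nat ((k + 2 * m) choose (k + m + 1))) *
     (of_nat (k + 2) * ((of_nat (k + m + 1) + \<mu>) gchoose (k + 2)))"
    unfolding pade_coeff_def idx(1) of_nat_mult by (simp only: mult_ac)
  also have "\<dots> = (of_nat m + \<mu>) * of_nat m * pade_coeff \<mu> (k + m + 1) (k + 1)"
    unfolding 1 2 pade_coeff_def idx(2) by (simp only: mult_ac)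
  finally show ?thesis .
qed

lemma pade_coeff_rec0:
  "of_nat (r + 1) * pade_coeff \<mu> (r + 1) 0 = 2 * of_nat (2 * r + 1) * pade_coeff \<mu> r 0"
proof -
  have "(r + 1) * ((2 * r + 2) choose (r + 1)) = (2 * r + 2) * ((2 * r + 1) choose r)"
    using Suc_times_binomial[of r "2 * r + 1"] by simp
  moreover have "(r + 1) * ((2 * r + 1) choose r) = (2 * r + 1) * ((2 * r) choose r)"
    using binomial_absorb_comp[of "2 * r + 1" r] by simp
  ultimately have "(r + 1) * ((r + 1) * ((2 * r + 2) choose (r + 1))) = (r + 1) * (2 * (2 * r + 1) * ((2 * r) choose r))"
    by algebra
  then have "(r + 1) * ((2 * r + 2) choose (r + 1)) = 2 * (2 * r + 1) * ((2 * r) choose r)"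
    by (simp only: Suc_eq_plus1[symmetric] Suc_mult_cancel1)
  then have "of_nat ((r + 1) * ((2 * r + 2) choose (r + 1))) = (of_nat (2 * (2 * r + 1) * ((2 * r) choose r)) :: 'a)"
    by (rule arg_cong)
  then have "of_nat (r + 1) * of_nat ((2 * r + 2) choose (r + 1)) = (2 * of_nat (2 * r + 1) * of_nat ((2 * r) choose r) :: 'a)"
    unfolding of_nat_mult of_nat_numeral .
  moreover have "2 * (r + 1) - 0 = 2 * r + 2" "2 * r - 0 = 2 * r" by auto
  ultimately show ?thesis unfolding pade_coeff_def gbinomial_0 mult_1_right by metis
qed

lemma pade_coeff_rec1:
  assumes "r > 0"
  shows "of_nat (r + 1) * pade_coeff \<mu> (r + 1) 1 =
    of_nat (2 * r + 1) * (2 * pade_coeff \<mu> r 1 + pade_coeff \<mu> r 0)"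
proof -
  have "(r + 1) * ((2 * r + 1) choose (r + 1)) = (2 * r + 1) * ((2 * r) choose r)"
    using Suc_times_binomial[of r "2 * r"] by simp
  then have 1: "of_nat (r + 1) * of_nat ((2 * r + 1) choose (r + 1)) = (of_nat (2 * r + 1) * of_nat ((2 * r) choose r) :: 'a)"
    by (metis of_nat_mult)
  have "r * (2 * ((2 * r - 1) choose r)) = r * ((2 * r) choose r)"
    using binomial_absorb_comp[of "2 * r" r] by auto
  then have "2 * ((2 * r - 1) choose r) = ((2 * r) choose r)" using assms by (metis mult_cancel1 not_gr_zero)
  then have 2: "2 * of_nat ((2 * r - 1) choose r) = (of_nat ((2 * r) choose r) :: 'a)"
    by (metis of_nat_mult of_nat_numeral)
  have "of_nat (r + 1) * pade_coeff \<mu> (r + 1) 1 =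
     (of_nat (r + 1) * of_nat ((2 * r + 1) choose (r + 1))) * (of_nat r + 1 + \<mu>)"
    unfolding pade_coeff_def by simp
  also have "\<dots> = of_nat (2 * r + 1) * (2 * of_nat ((2 * r - 1) choose r) * (of_nat r + \<mu>) + of_nat ((2 * r) choose r))"
    unfolding 1 2 by (simp add: algebra_simps)
  also have "\<dots> = of_nat (2 * r + 1) * (2 * pade_coeff \<mu> r 1 + pade_coeff \<mu> r 0)"
    unfolding pade_coeff_def by simp
  finally show ?thesis .
qed

lemma pade_coeff_rec2:
  fixes \<mu> :: "'a::field_char_0"
  assumes "r > 0"
  shows "of_nat (r * (r + 1)) * pade_coeff \<mu> (r + 1) (k + 2) =
    of_nat (2 * r + 1) * of_nat r * (2 * pade_coeff \<mu> r (k + 2) + pade_coeff \<mu> r (k + 1))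
      - ((of_nat r)\<^sup>2 - \<mu>\<^sup>2) * (if k < r then pade_coeff \<mu> (r - 1) k else 0)"
proof (cases "k < r")
  case False
  then show ?thesis using assms by (simp add: pade_coeff_eq_0)
next
  case True
  then obtain m where r: "r = k + m + 1"
    by (metis less_iff_Suc_add Suc_eq_plus1)
  define B where "B = pade_coeff \<mu> (k + m) k"
  define K M :: 'a where "K = of_nat k" and "M = of_nat m"
  have nz: "K + M + 1 \<noteq> 0" "K + 1 \<noteq> 0" "K + 2 \<noteq> 0" "K + 2 * M + 1 \<noteq> 0" "K + M + 2 \<noteq> 0"
  proof -
    have "of_nat (k + m + 1) \<noteq> (0::'a)" "of_nat (k + 1) \<noteq> (0::'a)" "of_nat (k + 2) \<noteq> (0::'a)"
      "of_nat (k + 2 * m + 1) \<noteq> (0::'a)" "of_nat (k + m + 2) \<noteq> (0::'a)"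
      unfolding of_nat_eq_0_iff by auto
    then show "K + M + 1 \<noteq> 0" "K + 1 \<noteq> 0" "K + 2 \<noteq> 0" "K + 2 * M + 1 \<noteq> 0" "K + M + 2 \<noteq> 0"
      unfolding K_def M_def by (simp_all add: algebra_simps)
  qed
  have R: "(of_nat r :: 'a) = K + M + 1" unfolding r K_def M_def by simp
  have "(K + M + 1) * (K + 1) * pade_coeff \<mu> r (k + 1) = (K + M + 1 + \<mu>) * (K + 2 * M + 1) * B"
    using pade_coeff_diag[of k m \<mu>] unfolding r B_def K_def M_def by (simp add: algebra_simps)
  then have c1: "pade_coeff \<mu> r (k + 1) = (K + M + 1 + \<mu>) * (K + 2 * M + 1) * B / ((K + M + 1) * (K + 1))"
    using nz by (metis mult_eq_0_iff nonzero_mult_div_cancel_left)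
  have c2: "(K + M + 2) * (K + 2) * pade_coeff \<mu> (r + 1) (k + 2) = (K + M + 2 + \<mu>) * (K + 2 * M + 2) * pade_coeff \<mu> r (k + 1)"
    using pade_coeff_diag[of "k + 1" m \<mu>] unfolding r K_def M_def by (simp add: algebra_simps)
  have "(K + 2) * (K + 2 * M + 1) * pade_coeff \<mu> r (k + 2) = (M + \<mu>) * M * pade_coeff \<mu> r (k + 1)"
    using pade_coeff_horiz[of k m \<mu>] unfolding r K_def M_def by (simp add: algebra_simps)
  then have c3: "pade_coeff \<mu> r (k + 2) = (M + \<mu>) * M * pade_coeff \<mu> r (k + 1) / ((K + 2) * (K + 2 * M + 1))"
    using nz by (metis mult_eq_0_iff nonzero_mult_div_cancel_left)
  define C where "C = B / ((K + M + 1) * (K + 1) * (K + 2))"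
  have BC: "B = C * ((K + M + 1) * (K + 1) * (K + 2))" unfolding C_def using nz by simp
  have c1': "pade_coeff \<mu> r (k + 1) = (K + M + 1 + \<mu>) * (K + 2 * M + 1) * C * (K + 2)"
    unfolding c1 BC using nz by (simp add: divide_simps)
  have c3': "pade_coeff \<mu> r (k + 2) = (M + \<mu>) * M * (K + M + 1 + \<mu>) * C"
    unfolding c3 c1' using nz by (simp add: divide_simps)
  have c2': "(K + M + 2) * pade_coeff \<mu> (r + 1) (k + 2) = (K + M + 2 + \<mu>) * (K + 2 * M + 2) * (K + M + 1 + \<mu>) * (K + 2 * M + 1) * C"
  proof -
    have "(K + 2) * ((K + M + 2) * pade_coeff \<mu> (r + 1) (k + 2)) =
        (K + 2) * ((K + M + 2 + \<mu>) * (K + 2 * M + 2) * (K + M + 1 + \<mu>) * (K + 2 * M + 1) * C)"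
      using c2 unfolding c1' by algebra
    then show ?thesis using nz(3) by simp
  qed
  have "of_nat (r * (r + 1)) * pade_coeff \<mu> (r + 1) (k + 2) = (K + M + 1) * ((K + M + 2) * pade_coeff \<mu> (r + 1) (k + 2))"
    using R by (simp add: algebra_simps)
  also have "\<dots> = (2 * (K + M + 1) + 1) * (K + M + 1) * (2 * pade_coeff \<mu> r (k + 2) + pade_coeff \<mu> r (k + 1))
      - ((K + M + 1)\<^sup>2 - \<mu>\<^sup>2) * B"
    unfolding c2' c3' c1' BC by algebra
  also have "\<dots> = of_nat (2 * r + 1) * of_nat r * (2 * pade_coeff \<mu> r (k + 2) + pade_coeff \<mu> r (k + 1))
      - ((of_nat r)\<^sup>2 - \<mu>\<^sup>2) * (if k < r then pade_coeff \<mu> (r - 1) k else 0)"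
  proof -
    have "of_nat (2 * r + 1) = 2 * (K + M + 1) + 1" unfolding of_nat_add of_nat_mult R by simp
    moreover have "pade_coeff \<mu> (r - 1) k = B" unfolding B_def r by simp
    ultimately show ?thesis using R True by simp
  qed
  finally show ?thesis .
qed

lemma pade_sum_rec:
  fixes \<mu> :: "'a::field_char_0"
  assumes r: "r > 0"
  shows "of_nat (r * (r + 1)) * pade_sum \<mu> d y (r + 1) =
    of_nat (2 * r + 1) * of_nat r * (2 * y + d) * pade_sum \<mu> d y r
      - d\<^sup>2 * ((of_nat r)\<^sup>2 - \<mu>\<^sup>2) * pade_sum \<mu> d y (r - 1)"
proof -
  let ?c = "pade_coeff \<mu>"
  obtain s where s: "r = Suc s" using r by (cases r) auto
  have split: "(\<Sum>k\<le>r + 1. f k) = f 0 + f 1 + (\<Sum>k\<le>s. f (k + 2))" for f :: "nat \<Rightarrow> 'a"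
    unfolding s by (simp add: sum.atMost_Suc_shift del: sum.atMost_Suc)
  have Sr: "pade_sum \<mu> d y r = (\<Sum>k\<le>r + 1. ?c r k * d ^ k * y ^ (r - k))"
    unfolding pade_sum_def using r by (simp add: pade_coeff_eq_0)
  have "y * pade_sum \<mu> d y r = (\<Sum>k\<le>r + 1. ?c r k * d ^ k * y ^ (r + 1 - k))"
    unfolding Sr sum_distrib_left
  proof (rule sum.cong[OF refl])
    fix k
    show "y * (?c r k * d ^ k * y ^ (r - k)) = ?c r k * d ^ k * y ^ (r + 1 - k)"
      using r by (cases "k \<le> r") (simp_all add: Suc_diff_le pade_coeff_eq_0)
  qed
  then have A: "y * pade_sum \<mu> d y r = ?c r 0 * y ^ (r + 1) + ?c r 1 * d * y ^ r
      + (\<Sum>k\<le>s. ?c r (k + 2) * (d ^ (k + 2) * y ^ (s - k)))"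
    unfolding split by (simp add: s mult_ac)
  have "d * pade_sum \<mu> d y r = (\<Sum>k\<le>r. ?c r k * d ^ (k + 1) * y ^ (r - k))"
    unfolding pade_sum_def sum_distrib_left by (simp add: mult_ac)
  then have B: "d * pade_sum \<mu> d y r = ?c r 0 * d * y ^ r
      + (\<Sum>k\<le>s. ?c r (k + 1) * (d ^ (k + 2) * y ^ (s - k)))"
    unfolding s by (simp add: sum.atMost_Suc_shift mult_ac del: sum.atMost_Suc)
  have C: "d\<^sup>2 * pade_sum \<mu> d y (r - 1) =
      (\<Sum>k\<le>s. (if k < r then ?c (r - 1) k else 0) * (d ^ (k + 2) * y ^ (s - k)))"
    unfolding pade_sum_def sum_distrib_left
    by (rule sum.cong) (auto simp: s power2_eq_square mult_ac)
  have D: "pade_sum \<mu> d y (r + 1) = ?c (r + 1) 0 * y ^ (r + 1) + ?c (r + 1) 1 * d * y ^ r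
      + (\<Sum>k\<le>s. ?c (r + 1) (k + 2) * (d ^ (k + 2) * y ^ (s - k)))"
    unfolding pade_sum_def split by (simp add: s mult_ac)
  have E0: "of_nat (r * (r + 1)) * ?c (r + 1) 0 = of_nat (2 * r + 1) * of_nat r * (2 * ?c r 0)"
    using pade_coeff_rec0[of r \<mu>] unfolding of_nat_mult by algebra
  have E1: "of_nat (r * (r + 1)) * ?c (r + 1) 1 = of_nat (2 * r + 1) * of_nat r * (2 * ?c r 1 + ?c r 0)"
    using pade_coeff_rec1[OF r, of \<mu>] unfolding of_nat_mult by algebra
  let ?R = "of_nat (2 * r + 1) * of_nat r :: 'a"
  let ?N = "of_nat (r * (r + 1)) :: 'a"
  let ?U = "(of_nat r)\<^sup>2 - \<mu>\<^sup>2"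
  define w where "w k = d ^ (k + 2) * y ^ (s - k)" for k
  have "?N * (\<Sum>k\<le>s. ?c (r + 1) (k + 2) * w k) =
      (\<Sum>k\<le>s. (?R * (2 * ?c r (k + 2) + ?c r (k + 1)) - ?U * (if k < r then ?c (r - 1) k else 0)) * w k)"
    unfolding sum_distrib_left pade_coeff_rec2[OF r, symmetric] by (simp only: mult.assoc)
  also have "\<dots> = ?R * (2 * (\<Sum>k\<le>s. ?c r (k + 2) * w k) + (\<Sum>k\<le>s. ?c r (k + 1) * w k))
      - ?U * (\<Sum>k\<le>s. (if k < r then ?c (r - 1) k else 0) * w k)"
    unfolding sum_distrib_left sum.distrib[symmetric] sum_subtractf[symmetric]
    by (rule sum.cong) (simp_all only: algebra_simps)
  finally have E2: "?N * (\<Sum>k\<le>s. ?c (r + 1) (k + 2) * w k) =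
      ?R * (2 * (\<Sum>k\<le>s. ?c r (k + 2) * w k) + (\<Sum>k\<le>s. ?c r (k + 1) * w k))
      - ?U * (\<Sum>k\<le>s. (if k < r then ?c (r - 1) k else 0) * w k)" .
  have "?N * pade_sum \<mu> d y (r + 1) =
      ?R * (2 * (y * pade_sum \<mu> d y r) + d * pade_sum \<mu> d y r) - ?U * (d\<^sup>2 * pade_sum \<mu> d y (r - 1))"
  proof -
    have dist: "?N * (a0 * x + a1 * d * z + u) = (?N * a0) * x + (?N * a1) * (d * z) + ?N * u" for a0 a1 x z u :: 'a
      by (simp only: algebra_simps)
    then show ?thesis
      unfolding A B C D w_def[symmetric] dist E0 E1 E2 by (simp only: algebra_simps)
  qed
  then show ?thesis by algebra
qed

section \<open>The continued fraction\<close>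

text \<open>Started with \<open>(u, v) = (1, t)\<close> and \<open>(0, 1)\<close> this yields the denominators \<open>P\<^sub>r\<close> and the numerators
  \<open>Q\<^sub>r\<close> of the convergents, with the powers of \<open>t\<close> cleared.\<close>

fun cf_sol :: "'a::comm_ring_1 \<Rightarrow> 'a \<Rightarrow> 'a \<Rightarrow> nat \<Rightarrow> 'a" where
  "cf_sol t u v 0 = u"
| "cf_sol t u v (Suc 0) = v"
| "cf_sol t u v (Suc (Suc r)) =
     of_nat (2 * r + 3) * t * cf_sol t u v (Suc r) + of_nat (16 * (r + 1)\<^sup>2 - 1) * cf_sol t u v r"

lemma cf_sol_linear:
  "cf_sol t (a * u + b * u') (a * v + b * v') r = a * cf_sol t u v r + b * cf_sol t u' v' r"
proof (induction t u v r rule: cf_sol.induct)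
qed (simp_all add: algebra_simps)

lemma cf_sol_bounds:
  fixes t :: real
  assumes "t \<ge> 0" "l \<ge> 0" "l\<^sup>2 = 2 * t * l + 16" "0 \<le> u" "u \<le> 1" "0 \<le> v" "v \<le> l"
  shows "0 \<le> cf_sol t u v r \<and> cf_sol t u v r \<le> fact r * l ^ r"
  using assms
proof (induction t u v r rule: cf_sol.induct)
  case (3 t u v r)
  let ?X = "cf_sol t u v"
  have IH: "0 \<le> ?X (Suc r)" "?X (Suc r) \<le> fact (Suc r) * l ^ Suc r" "0 \<le> ?X r" "?X r \<le> fact r * l ^ r"
    using 3 by auto
  have sq: "real (16 * (r + 1)\<^sup>2 - 1) = 16 * (real r + 1)\<^sup>2 - 1"
    by (simp add: of_nat_diff add.commute)
  have "real (2 * r + 3) * t * ?X (Suc r) \<le> (2 * (real r + 2)) * t * (fact (Suc r) * l ^ Suc r)"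
    using IH 3 by (intro mult_mono) auto
  moreover have "real (16 * (r + 1)\<^sup>2 - 1) * ?X r \<le> (16 * (real r + 2) * (real r + 1)) * (fact r * l ^ r)"
    unfolding sq using IH by (intro mult_mono) (auto simp: power2_eq_square algebra_simps)
  ultimately have "?X (Suc (Suc r)) \<le> (2 * (real r + 2)) * t * (fact (Suc r) * l ^ Suc r) + (16 * (real r + 2) * (real r + 1)) * (fact r * l ^ r)"
    by simp
  also have "\<dots> = (real r + 2) * (real r + 1) * fact r * l ^ r * (2 * t * l + 16)"
    by (simp add: algebra_simps)
  also have "\<dots> = fact (Suc (Suc r)) * l ^ Suc (Suc r)"
    unfolding 3(5)[symmetric] by (simp add: algebra_simps power2_eq_square)
  finally have "?X (Suc (Suc r)) \<le> fact (Suc (Suc r)) * l ^ Suc (Suc r)" .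
  moreover have "0 \<le> ?X (Suc (Suc r))"
    unfolding cf_sol.simps(3) using IH 3 by (intro add_nonneg_nonneg mult_nonneg_nonneg of_nat_0_le_iff) simp_all
  ultimately show ?case by blast
qed auto

lemma cf_sol_lower:
  fixes t :: real
  assumes "t > 0" "l > 0" "l\<^sup>2 = 2 * t * l + 16"
  shows "t * (fact r * l ^ r) \<le> cf_sol t 1 t (Suc r)"
  using assms
proof (induction r rule: induct_nat_012)
  case 0
  then show ?case by simp
next
  case 1
  have "l * (l - 2 * t) = 16" using assms by (simp add: algebra_simps power2_eq_square)
  moreover from this have "l > 2 * t" using assms(2) zero_less_mult_pos[of l "l - 2 * t"] by simp
  moreover from this have "2 * t * (l - 2 * t) \<le> l * (l - 2 * t)" by (intro mult_right_mono) auto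
  ultimately have "t * (l - 2 * t) \<le> 8" by simp
  moreover have "0 \<le> t * t" by simp
  ultimately have "t * l \<le> 3 * (t * t) + 15" unfolding right_diff_distrib by (simp only: mult_ac)
  then show ?case by (simp add: numeral_3_eq_3 )
next
  case (ge2 r)
  let ?X = "cf_sol t 1 t"
  have IH: "t * (fact r * l ^ r) \<le> ?X (Suc r)" "t * (fact (Suc r) * l ^ Suc r) \<le> ?X (Suc (Suc r))"
    using ge2 by auto
  have sq: "real (16 * (Suc r + 1)\<^sup>2 - 1) = 16 * (real r + 2)\<^sup>2 - 1"
    by (simp add: of_nat_diff add.commute)
  have "(2 * (real r + 2)) * t * (t * (fact (Suc r) * l ^ Suc r)) \<le> real (2 * Suc r + 3) * t * ?X (Suc (Suc r))"
    using IH ge2 by (intro mult_mono) auto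
  moreover have "(16 * (real r + 2) * (real r + 1)) * (t * (fact r * l ^ r)) \<le> real (16 * (Suc r + 1)\<^sup>2 - 1) * ?X (Suc r)"
    unfolding sq using IH ge2 by (intro mult_mono) (auto simp: power2_eq_square algebra_simps)
  ultimately have "(2 * (real r + 2)) * t * (t * (fact (Suc r) * l ^ Suc r)) + (16 * (real r + 2) * (real r + 1)) * (t * (fact r * l ^ r))
     \<le> ?X (Suc (Suc (Suc r)))"
    by simp
  also have "(2 * (real r + 2)) * t * (t * (fact (Suc r) * l ^ Suc r)) + (16 * (real r + 2) * (real r + 1)) * (t * (fact r * l ^ r))
    = t * ((real r + 2) * (real r + 1) * fact r * l ^ r * (2 * t * l + 16))"
    by (simp add: algebra_simps)
  also have "\<dots> = t * (fact (Suc (Suc r)) * l ^ Suc (Suc r))"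
    unfolding ge2(5)[symmetric] by (simp add: algebra_simps power2_eq_square)
  finally show ?case .
qed

lemma cf_sol_det:
  "cf_sol t 1 t r * cf_sol t 0 1 (Suc r) - cf_sol t 1 t (Suc r) * cf_sol t 0 1 r =
     (\<Prod>j = 1..r. - of_nat (16 * j\<^sup>2 - 1))"
proof (induction r)
  case (Suc r)
  have "cf_sol t 1 t (Suc r) * cf_sol t 0 1 (Suc (Suc r)) - cf_sol t 1 t (Suc (Suc r)) * cf_sol t 0 1 (Suc r) =
     - of_nat (16 * (r + 1)\<^sup>2 - 1) * (cf_sol t 1 t r * cf_sol t 0 1 (Suc r) - cf_sol t 1 t (Suc r) * cf_sol t 0 1 r)"
    by (simp only: cf_sol.simps(3)) (simp add: algebra_simps)
  then show ?case unfolding Suc by (simp add: mult.commute)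
qed simp

lemma abs_det_bounds:
  "0 < \<bar>\<Prod>j = 1..r. - real (16 * j\<^sup>2 - 1)\<bar>" "\<bar>\<Prod>j = 1..r. - real (16 * j\<^sup>2 - 1)\<bar> \<le> 16 ^ r * (fact r)\<^sup>2"
proof -
  have pos: "0 < 16 * j\<^sup>2 - 1" if "j \<ge> 1" for j :: nat
  proof -
    have "1 \<le> j\<^sup>2" using that by simp
    then show ?thesis by linarith
  qed
  have "(\<Prod>j = 1..r. - real (16 * j\<^sup>2 - 1)) \<noteq> 0"
    unfolding prod_zero_iff[OF finite_atLeastAtMost]
    using pos by (metis atLeastAtMost_iff less_numeral_extra(3) neg_equal_0_iff_equal of_nat_eq_0_iff)
  then show "0 < \<bar>\<Prod>j = 1..r. - real (16 * j\<^sup>2 - 1)\<bar>" by simp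
  have "\<bar>\<Prod>j = 1..r. - real (16 * j\<^sup>2 - 1)\<bar> = (\<Prod>j = 1..r. real (16 * j\<^sup>2 - 1))"
    by (simp only: abs_prod abs_minus_cancel abs_of_nat)
  also have "\<dots> \<le> (\<Prod>j = 1..r. 16 * (real j * real j))"
  proof (intro prod_mono conjI of_nat_0_le_iff)
    fix j
    have "real (16 * j\<^sup>2 - 1) \<le> real (16 * j\<^sup>2)" by (rule of_nat_mono) simp
    then show "real (16 * j\<^sup>2 - 1) \<le> 16 * (real j * real j)" by (simp add: power2_eq_square)
  qed
  also have "\<dots> = 16 ^ r * (fact r)\<^sup>2"
    unfolding prod.distrib by (simp add: fact_prod power2_eq_square)
  finally show "\<bar>\<Prod>j = 1..r. - real (16 * j\<^sup>2 - 1)\<bar> \<le> 16 ^ r * (fact r)\<^sup>2" .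
qed

section \<open>Sign of the remainder\<close>

definition theta :: "real \<Rightarrow> real" where "theta t = arctan (4 / t) / 4"

definition cf_rem :: "nat \<Rightarrow> real \<Rightarrow> real" where
  "cf_rem r t = cf_sol t (- sin (theta t)) (cos (theta t) - t * sin (theta t)) r"

lemma cf_rem_Suc_Suc:
  "cf_rem (Suc (Suc r)) t = (2 * real r + 3) * t * cf_rem (Suc r) t + (16 * (real r + 1)\<^sup>2 - 1) * cf_rem r t"
  unfolding cf_rem_def by (simp add: of_nat_diff add.commute)

lemma cf_rem_eq: "cf_rem r t = cos (theta t) * cf_sol t 0 1 r - sin (theta t) * cf_sol t 1 t r"
  using cf_sol_linear[of t "cos (theta t)" 0 "- sin (theta t)" 1 1 t r] unfolding cf_rem_def
  by (simp add: mult.commute)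

lemma DERIV_theta:
  assumes "t > 0"
  shows "(theta has_real_derivative - 1 / (t\<^sup>2 + 16)) (at t)"
proof -
  have "t\<^sup>2 + 16 > 0" by (simp add: add_nonneg_pos)
  then show ?thesis unfolding theta_def using assms
    by (auto intro!: derivative_eq_intros simp: divide_simps) (simp add: power2_eq_square algebra_simps)
qed

text \<open>Writing \<open>R\<^sub>r\<close> for \<open>cf_rem r\<close>, the recurrence turns this into the lowering relation
  \<open>(t\<^sup>2 + 16) R\<^sub>r' = r t R\<^sub>r + (16 r\<^sup>2 - 1) R\<^sub>r\<^sub>-\<^sub>1\<close>.\<close>

lemma DERIV_cf_rem:
  assumes "t > 0"
  shows "(cf_rem r has_real_derivative (cf_rem (Suc r) t - (real r + 1) * t * cf_rem r t) / (t\<^sup>2 + 16)) (at t)"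
proof (induction r rule: induct_nat_012)
  case 0
  then show ?case unfolding cf_rem_def cf_sol.simps
    by (rule derivative_eq_intros DERIV_theta refl assms)+ simp
next
  case 1
  have W: "t\<^sup>2 + 16 \<noteq> 0" by (metis add_nonneg_eq_0_iff zero_le_numeral zero_le_power2 zero_neq_numeral)
  have "cf_rem (Suc (Suc 0)) t = 3 * t * (cos (theta t) - t * sin (theta t)) - 15 * sin (theta t)"
    unfolding cf_rem_Suc_Suc by (simp add: cf_rem_def)
  then show ?case
    unfolding One_nat_def cf_rem_def[of "Suc 0"] cf_sol.simps
    apply simp
    apply (rule derivative_eq_intros DERIV_theta refl assms)+
    using W by (simp add: divide_simps) (simp add: algebra_simps power2_eq_square)
next
  case (ge2 r)
  define W where "W = t\<^sup>2 + 16"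
  have W: "W \<noteq> 0" unfolding W_def by (metis add_nonneg_eq_0_iff zero_le_numeral zero_le_power2 zero_neq_numeral)
  have "((\<lambda>t. (2 * real r + 3) * t * cf_rem (Suc r) t + (16 * (real r + 1)\<^sup>2 - 1) * cf_rem r t)
     has_real_derivative (2 * real r + 3) * (cf_rem (Suc r) t + t * ((cf_rem (Suc (Suc r)) t - (real (Suc r) + 1) * t * cf_rem (Suc r) t) / W))
      + (16 * (real r + 1)\<^sup>2 - 1) * ((cf_rem (Suc r) t - (real r + 1) * t * cf_rem r t) / W)) (at t)"
    unfolding W_def by (rule derivative_eq_intros ge2 refl)+ (simp add: algebra_simps)
  moreover have "(2 * real r + 3) * (cf_rem (Suc r) t + t * ((cf_rem (Suc (Suc r)) t - (real (Suc r) + 1) * t * cf_rem (Suc r) t) / W))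
      + (16 * (real r + 1)\<^sup>2 - 1) * ((cf_rem (Suc r) t - (real r + 1) * t * cf_rem r t) / W)
     = (cf_rem (Suc (Suc (Suc r))) t - (real (Suc (Suc r)) + 1) * t * cf_rem (Suc (Suc r)) t) / W"
    unfolding cf_rem_Suc_Suc using W 
    by (simp add: divide_simps) (simp add: W_def algebra_simps power2_eq_square)
  ultimately show ?case unfolding cf_rem_Suc_Suc[abs_def, symmetric] W_def by simp
qed

lemma tendsto_theta: "(theta \<longlongrightarrow> 0) at_top"
proof -
  have "((\<lambda>t::real. 4 / t) \<longlongrightarrow> 0) at_top"
    by (intro tendsto_divide_0[OF tendsto_const] filterlim_at_top_imp_at_infinity filterlim_ident)
  then have "((\<lambda>t::real. arctan (4 / t) / 4) \<longlongrightarrow> arctan 0 / 4) at_top"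
    by (intro tendsto_intros) auto
  then show ?thesis unfolding theta_def by simp
qed

lemma tendsto_cf_rem: "((\<lambda>t. cf_rem r t / t ^ r) \<longlongrightarrow> 0) at_top"
proof (induction r rule: induct_nat_012)
  case 0
  have "((\<lambda>t. - sin (theta t)) \<longlongrightarrow> - sin 0) at_top" by (intro tendsto_intros tendsto_theta)
  then show ?case by (simp add: cf_rem_def)
next
  case 1
  have inv: "((\<lambda>t::real. 1 / t) \<longlongrightarrow> 0) at_top"
    by (intro tendsto_divide_0[OF tendsto_const] filterlim_at_top_imp_at_infinity filterlim_ident)
  have "((\<lambda>t. cos (theta t) * (1 / t) - sin (theta t)) \<longlongrightarrow> cos 0 * 0 - sin 0) at_top"
    by (intro tendsto_intros tendsto_theta inv)
  then have "((\<lambda>t. cos (theta t) * (1 / t) - sin (theta t)) \<longlongrightarrow> 0) at_top" by simp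
  then have "((\<lambda>t. cf_rem (Suc 0) t / t ^ Suc 0) \<longlongrightarrow> 0) at_top"
  proof (rule Lim_transform_eventually)
    show "\<forall>\<^sub>F t in at_top. cos (theta t) * (1 / t) - sin (theta t) = cf_rem (Suc 0) t / t ^ Suc 0"
      by (rule eventually_mono[OF eventually_gt_at_top[of 0]]) (simp add: cf_rem_def divide_simps)
  qed
  then show ?case by simp
next
  case (ge2 r)
  have inv: "((\<lambda>t::real. 1 / t) \<longlongrightarrow> 0) at_top"
    by (intro tendsto_divide_0[OF tendsto_const] filterlim_at_top_imp_at_infinity filterlim_ident)
  have "((\<lambda>t. (2 * real r + 3) * (cf_rem (Suc r) t / t ^ Suc r) +
      (16 * (real r + 1)\<^sup>2 - 1) * ((1 / t) * (1 / t) * (cf_rem r t / t ^ r)))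
     \<longlongrightarrow> (2 * real r + 3) * 0 + (16 * (real r + 1)\<^sup>2 - 1) * (0 * 0 * 0)) at_top"
    by (intro tendsto_intros ge2 inv)
  then have "((\<lambda>t. (2 * real r + 3) * (cf_rem (Suc r) t / t ^ Suc r) +
      (16 * (real r + 1)\<^sup>2 - 1) * ((1 / t) * (1 / t) * (cf_rem r t / t ^ r))) \<longlongrightarrow> 0) at_top" by simp
  then show ?case
  proof (rule Lim_transform_eventually)
    show "\<forall>\<^sub>F t in at_top. (2 * real r + 3) * (cf_rem (Suc r) t / t ^ Suc r) +
      (16 * (real r + 1)\<^sup>2 - 1) * ((1 / t) * (1 / t) * (cf_rem r t / t ^ r)) = cf_rem (Suc (Suc r)) t / t ^ Suc (Suc r)"
      by (rule eventually_mono[OF eventually_gt_at_top[of 0]])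
        (simp add: cf_rem_Suc_Suc field_simps)
  qed
qed

text \<open>By the lowering relation \<open>R\<^sub>r / (t\<^sup>2 + 16) powr (r / 2)\<close> has a derivative of the sign of \<open>R\<^sub>r\<^sub>-\<^sub>1\<close>,
  and it tends to \<open>0\<close> at infinity; so \<open>R\<^sub>r\<close> has the opposite sign.\<close>

lemma cf_rem_sign: "t > 0 \<Longrightarrow> (-1) ^ r * cf_rem r t < 0"
proof (induction r arbitrary: t)
  case 0
  have "0 < theta t" "theta t < pi"
    using 0 arctan_bounded[of "4 / t"] pi_gt_zero unfolding theta_def by auto
  then show ?case by (simp add: cf_rem_def sin_gt_zero)
next
  case (Suc r)
  define n where "n = real (Suc r)"
  define f where "f x = (-1) ^ r * (cf_rem (Suc r) x * (x\<^sup>2 + 16) powr (- n / 2))" for x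
  have W: "x\<^sup>2 + 16 > 0" for x :: real by (simp add: add_nonneg_pos)
  have "0 < f t"
  proof (rule DERIV_neg_imp_decreasing_at_top[where f = f])
    fix x assume "t \<le> x"
    then have x: "x > 0" using Suc.prems by simp
    define w where "w = (x\<^sup>2 + 16) powr (- n / 2)"
    have w: "w > 0" unfolding w_def using W[of x] by simp
    have "((\<lambda>x. (x\<^sup>2 + 16) powr (- n / 2)) has_real_derivative - n / 2 * (x\<^sup>2 + 16) powr (- n / 2 - 1) * (2 * x)) (at x)"
      using W[of x] by (auto intro!: derivative_eq_intros)
    moreover have "- n / 2 * (x\<^sup>2 + 16) powr (- n / 2 - 1) * (2 * x) = - n * x * w / (x\<^sup>2 + 16)"
      using W[of x] unfolding powr_diff w_def by (simp add: divide_simps)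
    ultimately have D1: "((\<lambda>x. (x\<^sup>2 + 16) powr (- n / 2)) has_real_derivative - n * x * w / (x\<^sup>2 + 16)) (at x)"
      by simp
    have "(f has_real_derivative (-1) ^ r * ((cf_rem (Suc (Suc r)) x - (real (Suc r) + 1) * x * cf_rem (Suc r) x) / (x\<^sup>2 + 16) * w
       + cf_rem (Suc r) x * (- n * x * w / (x\<^sup>2 + 16)))) (at x)"
      unfolding f_def by (rule derivative_eq_intros DERIV_cf_rem D1 x refl)+ (simp add: w_def algebra_simps)
    moreover have "(-1) ^ r * ((cf_rem (Suc (Suc r)) x - (real (Suc r) + 1) * x * cf_rem (Suc r) x) / (x\<^sup>2 + 16) * w
       + cf_rem (Suc r) x * (- n * x * w / (x\<^sup>2 + 16))) =
       (16 * (real r + 1)\<^sup>2 - 1) * w / (x\<^sup>2 + 16) * ((-1) ^ r * cf_rem r x)"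
      unfolding cf_rem_Suc_Suc n_def using W[of x] by (simp add: divide_simps) (simp add: algebra_simps)
    moreover have "(16 * (real r + 1)\<^sup>2 - 1) * w / (x\<^sup>2 + 16) * ((-1) ^ r * cf_rem r x) < 0"
    proof (rule mult_pos_neg)
      have "1 \<le> (real r + 1)\<^sup>2" by simp
      then have "16 * (real r + 1)\<^sup>2 - 1 > 0" by linarith
      then show "(16 * (real r + 1)\<^sup>2 - 1) * w / (x\<^sup>2 + 16) > 0" using w W[of x] by simp
    qed (rule Suc.IH[OF x])
    ultimately show "\<exists>y. (f has_real_derivative y) (at x) \<and> y < 0" by auto
  next
    show "(f \<longlongrightarrow> 0) at_top"
    proof (rule tendsto_rabs_zero_cancel, rule tendsto_sandwich[OF _ _ tendsto_const])
      show "\<forall>\<^sub>F x in at_top. 0 \<le> \<bar>f x\<bar>" by simp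
      show "((\<lambda>x. \<bar>cf_rem (Suc r) x / x ^ Suc r\<bar>) \<longlongrightarrow> 0) at_top"
        using tendsto_cf_rem by (rule tendsto_rabs_zero)
      show "\<forall>\<^sub>F x in at_top. \<bar>f x\<bar> \<le> \<bar>cf_rem (Suc r) x / x ^ Suc r\<bar>"
      proof (rule eventually_mono[OF eventually_gt_at_top[of 0]])
        fix x :: real assume x: "x > 0"
        have "x ^ Suc r = x powr n" unfolding n_def using x by (simp add: powr_realpow del: of_nat_Suc)
        also have "\<dots> = (x\<^sup>2) powr (n / 2)" using x by (simp add: powr_powr flip: powr_numeral)
        also have "\<dots> \<le> (x\<^sup>2 + 16) powr (n / 2)" by (intro powr_mono2) (auto simp: n_def)
        finally have "(x\<^sup>2 + 16) powr (- n / 2) \<le> 1 / x ^ Suc r"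
          using x W[of x] by (simp add: powr_minus_divide frac_le)
        then have "\<bar>cf_rem (Suc r) x\<bar> * (x\<^sup>2 + 16) powr (- n / 2) \<le> \<bar>cf_rem (Suc r) x\<bar> * (1 / x ^ Suc r)"
          by (rule mult_left_mono) simp
        then show "\<bar>f x\<bar> \<le> \<bar>cf_rem (Suc r) x / x ^ Suc r\<bar>"
          using x unfolding f_def by (simp add: abs_mult power_abs)
      qed
    qed
  qed
  then have "0 < (-1) ^ r * cf_rem (Suc r) t * (t\<^sup>2 + 16) powr (- n / 2)" unfolding f_def by (simp add: mult.assoc)
  then have "0 < (-1) ^ r * cf_rem (Suc r) t"
    using W[of t] by (simp add: zero_less_mult_iff)
  then show ?case by simp
qed

section \<open>Integrality\<close>

lemma pade_sum_eq_cf_sol: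
  fixes t :: complex
  shows "fact r * pade_sum (1 / 4) (8 * \<i>) (t - 4 * \<i>) r = 2 ^ r * cf_sol t 1 (t + \<i>) r"
proof (induction r rule: induct_nat_012)
  case 0
  show ?case by (simp add: pade_sum_def pade_coeff_def)
next
  case 1
  show ?case by (simp add: pade_sum_def pade_coeff_def algebra_simps)
next
  case (ge2 n)
  let ?S = "pade_sum (1 / 4) (8 * \<i>) (t - 4 * \<i>)"
  let ?A = "cf_sol t 1 (t + \<i>)"
  define N :: complex where "N = of_nat n"
  define c where "c = 16 * (N + 1)\<^sup>2 - 1"
  have c: "of_nat (16 * (n + 1)\<^sup>2 - 1) = c" unfolding c_def N_def by (simp add: of_nat_diff add.commute)
  have rec: "(N + 1) * (N + 2) * ?S (Suc (Suc n)) =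
      (2 * N + 3) * (N + 1) * (2 * t) * ?S (Suc n) + 4 * c * ?S n"
    using pade_sum_rec[of "Suc n" "1 / 4" "8 * \<i>" "t - 4 * \<i>"]
    by (simp add: N_def c_def power_mult_distrib power_divide algebra_simps)
  have f: "fact (Suc n) = (N + 1) * (fact n :: complex)" "fact (Suc (Suc n)) = (N + 1) * (N + 2) * (fact n :: complex)"
    unfolding N_def by (simp_all add: algebra_simps)
  have "fact (Suc (Suc n)) * ?S (Suc (Suc n)) = fact n * ((N + 1) * (N + 2) * ?S (Suc (Suc n)))"
    unfolding f by (simp only: mult_ac)
  also have "\<dots> = (2 * N + 3) * (2 * t) * (fact (Suc n) * ?S (Suc n)) + 4 * c * (fact n * ?S n)"
    unfolding rec f by (simp only: algebra_simps)
  also have "\<dots> = 2 ^ Suc (Suc n) * ((2 * N + 3) * t * ?A (Suc n) + c * ?A n)"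
    unfolding ge2 by (simp add: algebra_simps)
  also have "(2 * N + 3) * t * ?A (Suc n) + c * ?A n = ?A (Suc (Suc n))"
    unfolding cf_sol.simps c N_def by simp
  finally show ?case .
qed

lemma Gaussian_mult:
  "Re z \<in> \<int> \<and> Im z \<in> \<int> \<Longrightarrow> Re w \<in> \<int> \<and> Im w \<in> \<int> \<Longrightarrow> Re (z * w) \<in> \<int> \<and> Im (z * w) \<in> \<int>"
  by simp

lemma Gaussian_power: "Re z \<in> \<int> \<and> Im z \<in> \<int> \<Longrightarrow> Re (z ^ n) \<in> \<int> \<and> Im (z ^ n) \<in> \<int>"
  by (induction n) simp_all

lemma pade_sum_Gaussian:
  fixes t :: int and r :: nat
  defines "z \<equiv> pade_sum (1 / 4) (8 * \<i>) (of_int t - 4 * \<i>) r"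
  shows "Re z \<in> \<int> \<and> Im z \<in> \<int>"
proof -
  let ?g = "\<lambda>k. (of_nat ((2 * r - k) choose r) * (8 ^ k * ((of_nat r + 1 / 4) gchoose k))) * \<i> ^ k *
     (of_int t - 4 * \<i>) ^ (r - k) :: complex"
  have z: "z = (\<Sum>k\<le>r. ?g k)"
    unfolding z_def pade_sum_def pade_coeff_def by (simp add: power_mult_distrib mult_ac)
  have g: "Re (?g k) \<in> \<int> \<and> Im (?g k) \<in> \<int>" for k
  proof -
    have "8 ^ k * ((of_nat r + 1 / 4) gchoose k) \<in> (\<int> :: complex set)"
      by (rule gbinomial_quarter_Ints)
    then obtain a where a: "8 ^ k * ((of_nat r + 1 / 4) gchoose k) = (of_int a :: complex)"
      by (auto elim: Ints_cases)
    show ?thesis unfolding a by (intro Gaussian_mult Gaussian_power) simp_all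
  qed
  show ?thesis unfolding z Re_sum Im_sum using g by (blast intro: Ints_sum)
qed

lemma cf_sol_of_real:
  "cf_sol (of_real t) (of_real u) (of_real v) r = (of_real (cf_sol t u v r) :: complex)"
  by (induction t u v r rule: cf_sol.induct) simp_all

lemma cf_sol_scaled_Ints:
  fixes t :: int and r :: nat
  shows "2 ^ r / fact r * cf_sol (real_of_int t) 1 (real_of_int t) r \<in> \<int>"
    and "2 ^ r / fact r * cf_sol (real_of_int t) 0 1 r \<in> \<int>"
proof -
  let ?T = "real_of_int t"
  define x y where "x = 2 ^ r / fact r * cf_sol ?T 1 ?T r" and "y = 2 ^ r / fact r * cf_sol ?T 0 1 r"
  have "cf_sol (of_real ?T) 1 (of_real ?T + \<i>) r = complex_of_real (cf_sol ?T 1 ?T r) + \<i> * complex_of_real (cf_sol ?T 0 1 r)"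
    using cf_sol_linear[of "complex_of_real ?T" 1 1 \<i> 0 "of_real ?T" 1 r]
      cf_sol_of_real[of ?T 1 ?T r] cf_sol_of_real[of ?T 0 1 r] by simp
  then have "pade_sum (1 / 4) (8 * \<i>) (of_int t - 4 * \<i>) r =
      2 ^ r / fact r * (complex_of_real (cf_sol ?T 1 ?T r) + \<i> * complex_of_real (cf_sol ?T 0 1 r))"
    using pade_sum_eq_cf_sol[of r "of_int t"] by (simp add: field_simps)
  also have "\<dots> = complex_of_real (2 ^ r / fact r * cf_sol ?T 1 ?T r) + \<i> * complex_of_real (2 ^ r / fact r * cf_sol ?T 0 1 r)"
    by (simp add: algebra_simps)
  finally have e: "pade_sum (1 / 4) (8 * \<i>) (of_int t - 4 * \<i>) r = complex_of_real x + \<i> * complex_of_real y"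
    unfolding x_def y_def .
  show "2 ^ r / fact r * cf_sol ?T 1 ?T r \<in> \<int>" "2 ^ r / fact r * cf_sol ?T 0 1 r \<in> \<int>"
    using pade_sum_Gaussian[of t r] unfolding e x_def[symmetric] y_def[symmetric] by simp_all
qed

section \<open>Approximation of the roots\<close>

lemma eps_rho_bounds:
  assumes "t \<ge> 128"
  shows "real_of_int t / 2 \<le> eps t" "eps t \<le> real_of_int t / 2 + 2 / real_of_int t"
    "2 * (eps t)\<^sup>2 = real_of_int t * eps t + 2" "(rho t)\<^sup>2 = 1 + (eps t)\<^sup>2" "eps t \<le> rho t" "rho t \<le> eps t + 1"
proof -
  let ?T = "real_of_int t"
  have T: "?T \<ge> 128" using assms by simp
  have s2: "(sqrt (?T\<^sup>2 + 16))\<^sup>2 = ?T\<^sup>2 + 16" by simp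
  have l: "?T \<le> sqrt (?T\<^sup>2 + 16)" by (rule real_le_rsqrt) simp
  have u: "sqrt (?T\<^sup>2 + 16) \<le> ?T + 8 / ?T"
    by (rule real_le_lsqrt) (use T in \<open>simp_all add: power2_sum power_divide\<close>)
  show e: "?T / 2 \<le> eps t" using l unfolding eps_def by simp
  show "eps t \<le> ?T / 2 + 2 / ?T" using u unfolding eps_def by (simp add: field_simps)
  show "2 * (eps t)\<^sup>2 = ?T * eps t + 2"
    using s2 unfolding eps_def power_divide power2_sum by (simp add: field_simps power2_eq_square)
  show r2: "(rho t)\<^sup>2 = 1 + (eps t)\<^sup>2" unfolding rho_def by (simp add: add_nonneg_nonneg)
  have e0: "eps t \<ge> 0" using e T by simp
  show "eps t \<le> rho t" unfolding rho_def by (rule real_le_rsqrt) simp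
  show "rho t \<le> eps t + 1" unfolding rho_def using e0 by (intro real_le_lsqrt) (auto simp: power2_sum)
qed

lemma tan_theta:
  assumes "t \<ge> 128"
  shows "theta (real_of_int t) = arctan (rho t - eps t)"
proof -
  let ?T = "real_of_int t" and ?e = "eps t"
  define a where "a = rho t - ?e"
  note b = eps_rho_bounds[OF assms]
  have T: "?T \<ge> 128" using assms by simp
  have e: "?e \<ge> 64" using b(1) T by simp
  have qa: "1 - a\<^sup>2 = 2 * ?e * a" unfolding a_def using b(4) by (simp add: power2_diff algebra_simps power2_eq_square)
  have a0: "a \<ge> 0" unfolding a_def using b(5) by simp
  have ane: "a \<noteq> 0" using qa by auto
  have a1: "\<bar>a\<bar> < 1"
  proof -
    have "a\<^sup>2 < 1" using qa e a0 ane by (smt (verit) mult_pos_pos)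
    then show ?thesis by (simp add: abs_square_less_1)
  qed
  have "2 * arctan a = arctan (1 / ?e)"
    unfolding arctan_double[OF a1] qa using ane e by (simp add: field_simps)
  moreover have "2 * arctan (1 / ?e) = arctan (4 / ?T)"
  proof -
    have "2 * (1 / ?e) / (1 - (1 / ?e)\<^sup>2) = 2 * ?e / (?e\<^sup>2 - 1)" using e
      by (simp add: power_divide field_simps power2_eq_square)
    also have "?e\<^sup>2 - 1 = ?T * ?e / 2" using b(3) by simp
    also have "2 * ?e / (?T * ?e / 2) = 4 / ?T" using e by simp
    finally have "2 * (1 / ?e) / (1 - (1 / ?e)\<^sup>2) = 4 / ?T" .
    then show ?thesis using arctan_double[of "1 / ?e"] e by simp
  qed
  ultimately show ?thesis unfolding theta_def a_def by simp
qed

lemma integer_approximants: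
  assumes t: "t \<ge> 128"
  obtains P Q :: "nat \<Rightarrow> int" where
    "\<And>r. \<bar>real_of_int (P r)\<bar> \<le> (8 * eps t) ^ r"
    "\<And>r. \<bar>real_of_int (Q r)\<bar> \<le> (8 * eps t) ^ r"
    "\<And>r. \<bar>real_of_int (P r + Q r)\<bar> \<le> (8 * eps t) ^ r"
    "\<And>r. \<bar>real_of_int (P r - Q r)\<bar> \<le> (8 * eps t) ^ r"
    "\<And>r. \<bar>real_of_int (Q r) - (rho t - eps t) * real_of_int (P r)\<bar> \<le> 1 / real_of_int t / (eps t / 8) ^ r"
    "\<And>r. P r * Q (Suc r) \<noteq> P (Suc r) * Q r"
proof -
  define T where "T = real_of_int t"
  define l where "l = 4 * eps t"
  define a where "a = rho t - eps t"
  define s where "s r = 2 ^ r / (fact r :: real)" for r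
  define p where "p = cf_sol T 1 T"
  define q where "q = cf_sol T 0 1"
  have T: "T \<ge> 128" using t unfolding T_def by simp
  note b = eps_rho_bounds[OF t, folded T_def]
  have l2: "l\<^sup>2 = 2 * T * l + 16" using b(3) unfolding l_def by (simp add: power_mult_distrib)
  have lT: "l \<ge> 2 * T" using b(1) unfolding l_def by simp
  have s0: "s r > 0" for r unfolding s_def by simp
  obtain P where P: "\<And>r. real_of_int (P r) = s r * p r"
    using cf_sol_scaled_Ints(1)[of _ t] unfolding p_def T_def s_def Ints_def by (auto simp: image_iff) metis
  obtain Q where Q: "\<And>r. real_of_int (Q r) = s r * q r"
    using cf_sol_scaled_Ints(2)[of _ t] unfolding q_def T_def s_def Ints_def by (auto simp: image_iff) metis
  have bd: "\<bar>s r * cf_sol T u v r\<bar> \<le> (8 * eps t) ^ r" if "0 \<le> u" "u \<le> 1" "0 \<le> v" "v \<le> l" for u v r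
  proof -
    have "0 \<le> cf_sol T u v r \<and> cf_sol T u v r \<le> fact r * l ^ r"
      using cf_sol_bounds[of T l u v r] that T lT l2 by simp
    then have "\<bar>s r * cf_sol T u v r\<bar> \<le> s r * (fact r * l ^ r)"
      using s0[of r] by (simp add: abs_mult)
    also have "\<dots> = (2 * l) ^ r" unfolding s_def power_mult_distrib by simp
    finally show ?thesis unfolding l_def by simp
  qed
  have sum: "p r + q r = cf_sol T 1 (T + 1) r" "p r - q r = cf_sol T 1 (T - 1) r" for r
    using cf_sol_linear[of T 1 1 1 0 T 1 r] cf_sol_linear[of T 1 1 "- 1" 0 T 1 r]
    unfolding p_def q_def by simp_all
  have det: "\<bar>p r * q (Suc r) - p (Suc r) * q r\<bar> \<le> 16 ^ r * (fact r)\<^sup>2"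
    and det0: "p r * q (Suc r) - p (Suc r) * q r \<noteq> 0" for r
    using abs_det_bounds[of r] unfolding p_def q_def cf_sol_det by auto
  have rem: "\<bar>q r - a * p r\<bar> * p (Suc r) \<le> 16 ^ r * (fact r)\<^sup>2" for r
  proof -
    have th: "theta T = arctan a" unfolding T_def a_def by (rule tan_theta[OF t])
    have "cf_rem r T = cos (arctan a) * (q r - a * p r)" for r
      unfolding cf_rem_eq th p_def q_def
      using tan_arctan[of a] cos_arctan_not_zero[of a] by (simp add: tan_def field_simps)
    moreover have "cos (arctan a) > 0" by (intro cos_gt_zero_pi arctan_lbound arctan_ubound)
    ultimately have sgn: "(-1) ^ r * (q r - a * p r) < 0" for r
      using cf_rem_sign[of T r] T by (simp add: mult_less_0_iff zero_less_mult_iff)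
    have pos: "p r \<ge> 0" for r
      unfolding p_def using cf_sol_bounds[of T l 1 T r] T lT l2 by simp
    define x y where "x = (-1) ^ r * (q r - a * p r)" and "y = (-1) ^ r * (q (Suc r) - a * p (Suc r))"
    have xy: "x < 0" "y > 0" using sgn[of r] sgn[of "Suc r"] unfolding x_def y_def by simp_all
    have sign_abs: "\<bar>(-1) ^ r * z\<bar> = \<bar>z\<bar>" for z :: real by (simp add: abs_mult power_abs)
    have "\<bar>q r - a * p r\<bar> = - x" using xy(1) sign_abs[of "q r - a * p r"] unfolding x_def by linarith
    then have "\<bar>q r - a * p r\<bar> * p (Suc r) \<le> y * p r - x * p (Suc r)" using xy pos[of r] by simp
    also have "\<dots> = (-1) ^ r * (p r * q (Suc r) - p (Suc r) * q r)"
      unfolding x_def y_def by (simp add: algebra_simps)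
    also have "\<dots> \<le> \<bar>p r * q (Suc r) - p (Suc r) * q r\<bar>"
      using sign_abs abs_ge_self by metis
    finally show ?thesis using det[of r] by linarith
  qed
  show ?thesis
  proof (rule that[of P Q])
    fix r
    show "\<bar>real_of_int (P r)\<bar> \<le> (8 * eps t) ^ r"
      unfolding P p_def using lT T by (intro bd) auto
    show "\<bar>real_of_int (Q r)\<bar> \<le> (8 * eps t) ^ r"
      unfolding Q q_def using lT T by (intro bd) auto
    show "\<bar>real_of_int (P r + Q r)\<bar> \<le> (8 * eps t) ^ r"
      unfolding of_int_add P Q distrib_left[symmetric] sum using lT T by (intro bd) auto
    show "\<bar>real_of_int (P r - Q r)\<bar> \<le> (8 * eps t) ^ r"
      unfolding of_int_diff P Q right_diff_distrib[symmetric] sum using lT T by (intro bd) auto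
    have "real_of_int (P r * Q (Suc r) - P (Suc r) * Q r) = s r * s (Suc r) * (p r * q (Suc r) - p (Suc r) * q r)"
      unfolding of_int_mult of_int_diff P Q by (simp add: algebra_simps)
    also have "\<dots> \<noteq> 0" using det0[of r] s0[of r] s0[of "Suc r"] by simp
    finally show "P r * Q (Suc r) \<noteq> P (Suc r) * Q r" unfolding of_int_eq_0_iff by simp
    have low: "T * (fact r * l ^ r) \<le> p (Suc r)"
      unfolding p_def using cf_sol_lower[of T l r] T lT l2 by simp
    have "\<bar>q r - a * p r\<bar> * (T * (fact r * l ^ r)) \<le> 16 ^ r * (fact r)\<^sup>2"
      using mult_left_mono[OF low, of "\<bar>q r - a * p r\<bar>"] rem[of r] by simp
    then have "\<bar>q r - a * p r\<bar> \<le> 16 ^ r * fact r / (T * l ^ r)"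
      using T lT by (simp add: field_simps power2_eq_square)
    then have "s r * \<bar>q r - a * p r\<bar> \<le> s r * (16 ^ r * fact r / (T * l ^ r))"
      by (rule mult_left_mono) (simp add: less_imp_le[OF s0])
    also have "\<dots> = 32 ^ r / (T * l ^ r)" unfolding s_def by (simp add: power_mult_distrib[symmetric])
    also have "\<dots> = 1 / T / (l / 32) ^ r" by (simp add: power_divide)
    finally have "s r * \<bar>q r - a * p r\<bar> \<le> 1 / T / (eps t / 8) ^ r" unfolding l_def by simp
    moreover have "real_of_int (Q r) - a * real_of_int (P r) = s r * (q r - a * p r)"
      unfolding P Q by (simp add: algebra_simps)
    ultimately show "\<bar>real_of_int (Q r) - (rho t - eps t) * real_of_int (P r)\<bar> \<le> 1 / real_of_int t / (eps t / 8) ^ r"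
      using s0[of r] unfolding a_def T_def by (simp add: abs_mult)
  qed
qed

lemma irrationality_measure:
  fixes \<alpha> E K l :: real and a b :: "nat \<Rightarrow> int" and p q :: int
  assumes E: "E > 1" and K: "K \<ge> 1"
    and b: "\<And>r. \<bar>real_of_int (b r)\<bar> \<le> K ^ r"
    and err: "\<And>r. \<bar>real_of_int (b r) * \<alpha> - real_of_int (a r)\<bar> \<le> l / E ^ r"
    and det: "\<And>r. a r * b (Suc r) \<noteq> a (Suc r) * b r"
    and q: "2 * l * \<bar>real_of_int q\<bar> \<ge> 1"
  shows "\<bar>real_of_int p - \<alpha> * real_of_int q\<bar> >
    1 / (2 * K * (2 * l * E * \<bar>real_of_int q\<bar>) powr (ln K / ln E))"
proof -
  define x where "x = 2 * l * \<bar>real_of_int q\<bar>"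
  define y where "y = \<bar>real_of_int p - \<alpha> * real_of_int q\<bar>"
  \<comment> \<open>Of two consecutive approximants one differs from \<open>p / q\<close>; take them at the first index where the
    error term is below \<open>1 / 2\<close>.\<close>
  define N where "N = (LEAST N. x < E ^ N)"
  have "\<exists>N. x < E ^ N" by (rule real_arch_pow[OF E])
  then have N: "x < E ^ N" unfolding N_def by (rule LeastI_ex)
  have "N \<noteq> 0" using N q unfolding x_def by (intro notI) simp
  then obtain r where r: "N = Suc r" by (cases N) auto
  have "\<not> x < E ^ r" using not_less_Least[of r "\<lambda>N. x < E ^ N"] r unfolding N_def by simp
  then have lo: "E ^ r \<le> x" by simp
  have "\<exists>s. N \<le> s \<and> s \<le> Suc N \<and> p * b s \<noteq> q * a s"
  proof (rule ccontr)
    assume "\<not> ?thesis"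
    then have e: "p * b N = q * a N" "p * b (Suc N) = q * a (Suc N)" by auto
    have "q * (a N * b (Suc N)) = (p * b N) * b (Suc N)" unfolding e(1) by (simp add: mult_ac)
    also have "\<dots> = (p * b (Suc N)) * b N" by (simp only: mult_ac)
    also have "\<dots> = q * (a (Suc N) * b N)" unfolding e(2) by (simp add: mult_ac)
    finally have "q * (a N * b (Suc N)) = q * (a (Suc N) * b N)" .
    moreover have "q \<noteq> 0" using q by auto
    ultimately show False using det[of N] by simp
  qed
  then obtain s where s: "N \<le> s" "s \<le> Suc N" "p * b s \<noteq> q * a s" by blast
  have "1 \<le> \<bar>p * b s - q * a s\<bar>" using s(3) by linarith
  then have "1 \<le> \<bar>real_of_int (p * b s - q * a s)\<bar>" by linarith
  also have "real_of_int (p * b s - q * a s) =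
      real_of_int (b s) * (p - \<alpha> * q) + real_of_int q * (b s * \<alpha> - a s)"
    by (simp add: algebra_simps)
  also have "\<bar>\<dots>\<bar> \<le> \<bar>real_of_int (b s)\<bar> * y + \<bar>real_of_int q\<bar> * \<bar>b s * \<alpha> - a s\<bar>"
    unfolding y_def abs_mult[symmetric] by (rule abs_triangle_ineq)
  also have "\<dots> \<le> K ^ s * y + \<bar>real_of_int q\<bar> * (l / E ^ s)"
    using b[of s] err[of s] by (intro add_mono mult_right_mono mult_left_mono) (auto simp: y_def)
  also have "\<bar>real_of_int q\<bar> * (l / E ^ s) = x / E ^ s / 2" unfolding x_def by simp
  also have "x / E ^ s < 1"
  proof -
    have "E ^ N \<le> E ^ s" using E s(1) by (intro power_increasing) auto
    then have "x < E ^ s" using N by linarith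
    then show ?thesis using E by simp
  qed
  finally have "1 / 2 < K ^ s * y" by simp
  also have "\<dots> \<le> K ^ (r + 2) * y"
    using K s(2) r by (intro mult_right_mono power_increasing) (auto simp: y_def)
  finally have "1 / 2 < K ^ (r + 2) * y" .
  have K1: "K ^ (r + 1) \<le> (E * x) powr (ln K / ln E)"
  proof -
    have "ln E > 0" using E by simp
    then have EK: "E powr (ln K / ln E) = K" using E K by (simp add: powr_def)
    have "K ^ (r + 1) = (E powr (ln K / ln E)) powr real (r + 1)" using K unfolding EK by (simp add: powr_realpow del: of_nat_add of_nat_Suc power_Suc)
    also have "\<dots> = (E ^ (r + 1)) powr (ln K / ln E)"
      using E by (simp add: powr_powr powr_realpow[symmetric] mult.commute del: of_nat_add of_nat_Suc power_Suc)
    also have "\<dots> \<le> (E * x) powr (ln K / ln E)"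
      using lo E K by (intro powr_mono2) auto
    finally show ?thesis .
  qed
  have y0: "y \<ge> 0" unfolding y_def by simp
  have "1 / 2 < K * K ^ (r + 1) * y" using \<open>1 / 2 < K ^ (r + 2) * y\<close> by (simp add: mult_ac)
  also have "\<dots> \<le> K * (E * x) powr (ln K / ln E) * y"
    using K1 K y0 by (intro mult_right_mono mult_left_mono) auto
  finally have "1 < y * (2 * K * (E * x) powr (ln K / ln E))" by (simp add: mult_ac)
  moreover have "(E * x) powr (ln K / ln E) > 0" 
    using E q unfolding x_def by auto
  moreover have "E * x = 2 * l * E * \<bar>real_of_int q\<bar>" unfolding x_def by simp
  ultimately show ?thesis using K unfolding y_def[symmetric] by (simp add: divide_less_eq)
qed

lemma measure_with_constants:
  fixes \<alpha> l B C :: real and a b :: "nat \<Rightarrow> int"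
  assumes t: "t \<ge> 128"
    and b: "\<And>r. \<bar>real_of_int (b r)\<bar> \<le> (8 * eps t) ^ r"
    and err: "\<And>r. \<bar>real_of_int (b r) * \<alpha> - real_of_int (a r)\<bar> \<le> l / (eps t / 8) ^ r"
    and det: "\<And>r. a r * b (Suc r) \<noteq> a (Suc r) * b r"
    and q: "2 * l * \<bar>real_of_int q\<bar> \<ge> 1"
    and B: "l * eps t / 4 \<le> B" and C: "16 * eps t \<le> C"
  shows "\<bar>real_of_int p - \<alpha> * real_of_int q\<bar> > 1 / (C * B powr kappa t * \<bar>real_of_int q\<bar> powr kappa t)"
proof -
  have e: "eps t \<ge> 64" using eps_rho_bounds(1)[OF t] t by linarith
  have q0: "\<bar>real_of_int q\<bar> > 0" using q by auto
  have l0: "l > 0" using q q0 by (smt (verit) mult_nonpos_nonneg)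
  have k: "kappa t \<ge> 0" unfolding kappa_def using e by simp
  have pos: "0 < l * eps t / 4" using l0 e by simp
  have "2 * (8 * eps t) * (2 * l * (eps t / 8) * \<bar>real_of_int q\<bar>) powr kappa t =
     16 * eps t * (l * eps t / 4) powr kappa t * \<bar>real_of_int q\<bar> powr kappa t"
    using pos q0 by (simp add: powr_mult[symmetric])
  also have "\<dots> \<le> C * B powr kappa t * \<bar>real_of_int q\<bar> powr kappa t"
    using B C k pos e by (intro mult_right_mono mult_mono powr_mono2) auto
  finally have le: "2 * (8 * eps t) * (2 * l * (eps t / 8) * \<bar>real_of_int q\<bar>) powr kappa t \<le> C * B powr kappa t * \<bar>real_of_int q\<bar> powr kappa t" .
  have "0 < 2 * (8 * eps t) * (2 * l * (eps t / 8) * \<bar>real_of_int q\<bar>) powr kappa t"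
    using e l0 q0 by auto
  then have "1 / (C * B powr kappa t * \<bar>real_of_int q\<bar> powr kappa t) \<le> 1 / (2 * (8 * eps t) * (2 * l * (eps t / 8) * \<bar>real_of_int q\<bar>) powr kappa t)"
    using le by (rule frac_le[OF zero_le_one order_refl])
  also have "\<dots> < \<bar>real_of_int p - \<alpha> * real_of_int q\<bar>"
    using irrationality_measure[of "eps t / 8" "8 * eps t" b \<alpha> a l q p] b err det q e unfolding kappa_def by simp
  finally show ?thesis .
qed

theorem theorem3p1:
  fixes t p q :: int and j :: nat
  assumes "t \<ge> 128" and "j \<le> 3"
    and "real_of_int \<bar>q\<bar> > 0.16 * real_of_int t"
  shows "\<bar>real_of_int p - beta t j * real_of_int q\<bar>
           > 1 / (cconst t j * real_of_int \<bar>q\<bar> powr kappa t)"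
proof -
  note t = assms(1)
  define T where "T = real_of_int t"
  define a where "a = rho t - eps t"
  have T: "T \<ge> 128" using t unfolding T_def by simp
  note b = eps_rho_bounds[OF t, folded T_def]
  obtain P Q where PQ: 
    "\<And>r. \<bar>real_of_int (P r)\<bar> \<le> (8 * eps t) ^ r"
    "\<And>r. \<bar>real_of_int (Q r)\<bar> \<le> (8 * eps t) ^ r"
    "\<And>r. \<bar>real_of_int (P r + Q r)\<bar> \<le> (8 * eps t) ^ r"
    "\<And>r. \<bar>real_of_int (P r - Q r)\<bar> \<le> (8 * eps t) ^ r"
    "\<And>r. \<bar>real_of_int (Q r) - a * real_of_int (P r)\<bar> \<le> 1 / T / (eps t / 8) ^ r"
    "\<And>r. P r * Q (Suc r) \<noteq> P (Suc r) * Q r"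
    using integer_approximants[OF t] unfolding T_def a_def by metis
  have q: "\<bar>real_of_int q\<bar> > 0.16 * T" using assms(3) unfolding T_def by simp
  have e: "eps t \<ge> 64" using b(1) T by simp
  have "128 * 128 \<le> T * T" using T by (intro mult_mono) auto
  then have "2 / T \<le> 0.0002 * T" using T by (simp add: divide_le_eq)
  then have eu: "eps t \<le> 0.5002 * T" using b(2) T by simp
  have ab: "a * (rho t + eps t) = 1" unfolding a_def using b(4) by (simp add: algebra_simps power2_eq_square)
  have a0: "a \<ge> 0" unfolding a_def using b(5) by simp
  have a1: "a \<le> 1 / 100"
  proof -
    have "a * 100 \<le> a * (rho t + eps t)" using a0 b(5) e by (intro mult_left_mono) auto
    then show ?thesis using ab by simp
  qed
  have E0: "(eps t / 8) ^ r > 0" for r using e by simp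
  \<comment> \<open>The constant \<open>3.15\<close> in the error bounds is confined by \<open>2 * 3.15 * 0.16 \<ge> 1\<close> and
    \<open>3.15 / T * eps t / 4 \<le> 0.4\<close>, where \<open>eps t\<close> slightly exceeds \<open>T / 2\<close>.\<close>
  have C: "16 * eps t \<le> 8.01 * T" "16 * eps t \<le> 11.33 * T" using eu T by simp_all
  have B: "3.15 / T * eps t / 4 \<le> 0.4" "3.15 * eps t / 4 \<le> 0.4 * T" using eu T by (simp_all add: field_simps)
  have ql: "2 * (3.15 / T) * \<bar>real_of_int q\<bar> \<ge> 1" "2 * 3.15 * \<bar>real_of_int q\<bar> \<ge> 1"
    using q T by (simp_all add: field_simps)
  have err: "\<bar>x * (real_of_int (Q r) - a * real_of_int (P r))\<bar> \<le> l / (eps t / 8) ^ r"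
    if "\<bar>x\<bar> * (1 / T) \<le> l" for x l r
  proof -
    have "\<bar>x * (real_of_int (Q r) - a * real_of_int (P r))\<bar> \<le> \<bar>x\<bar> * (1 / T / (eps t / 8) ^ r)"
      unfolding abs_mult by (intro mult_left_mono PQ(5)) simp
    also have "\<dots> = (\<bar>x\<bar> * (1 / T)) / (eps t / 8) ^ r" by simp
    also have "\<dots> \<le> l / (eps t / 8) ^ r" using that E0[of r] by (intro divide_right_mono) auto
    finally show ?thesis .
  qed
  consider "j = 0" | "j = 1" | "j = 2" | "j = 3" using assms(2) by linarith
  then show ?thesis
  proof cases
    case 1
    have "real_of_int (P r) * (- a) - real_of_int (- Q r) = 1 * (real_of_int (Q r) - a * real_of_int (P r))" for r
      by simp
    then have "\<bar>real_of_int (P r) * (- a) - real_of_int (- Q r)\<bar> \<le> 3.15 / T / (eps t / 8) ^ r" for r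
      using T by (simp only:) (rule err, simp add: divide_simps)
    moreover have "- Q r * P (Suc r) \<noteq> - Q (Suc r) * P r" for r using PQ(6)[of r] by (simp add: mult.commute)
    ultimately have "\<bar>real_of_int p - (- a) * real_of_int q\<bar> > 1 / (11.33 * T * 0.4 powr kappa t * \<bar>real_of_int q\<bar> powr kappa t)"
      by (intro measure_with_constants[OF t PQ(1) _ _ ql(1) B(1) C(2), where a = "\<lambda>r. - Q r"])
    moreover have "beta t j = - a" using 1 unfolding beta_def a_def by simp
    ultimately show ?thesis using 1 unfolding cconst_def T_def by simp
  next
    case 2
    have bet: "beta t j = (1 - a) / (1 + a)"
      using 2 e b(4) a0 unfolding beta_def a_def by (simp add: divide_simps) (simp add: algebra_simps power2_eq_square)
    have "real_of_int (P r + Q r) * ((1 - a) / (1 + a)) - real_of_int (P r - Q r) = 2 / (1 + a) * (real_of_int (Q r) - a * real_of_int (P r))" for r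
      using a0 by (simp add: divide_simps) (simp add: algebra_simps)
    moreover have "\<bar>2 / (1 + a)\<bar> * (1 / T) \<le> 3.15 / T"
      using a0 T by (simp add: divide_simps)
    ultimately have "\<bar>real_of_int (P r + Q r) * ((1 - a) / (1 + a)) - real_of_int (P r - Q r)\<bar> \<le> 3.15 / T / (eps t / 8) ^ r" for r
      using err[of "2 / (1 + a)" "3.15 / T" r] by metis
    moreover have "(P r - Q r) * (P (Suc r) + Q (Suc r)) \<noteq> (P (Suc r) - Q (Suc r)) * (P r + Q r)" for r
      using PQ(6)[of r] by (simp add: algebra_simps)
    ultimately have "\<bar>real_of_int p - (1 - a) / (1 + a) * real_of_int q\<bar> > 1 / (11.33 * T * 0.4 powr kappa t * \<bar>real_of_int q\<bar> powr kappa t)"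
      by (intro measure_with_constants[OF t PQ(3) _ _ ql(1) B(1) C(2), where a = "\<lambda>r. P r - Q r"])
    then show ?thesis using 2 unfolding cconst_def T_def bet by simp
  next
    case 3
    define c where "c = rho t + eps t"
    have "real_of_int (Q r) * c - real_of_int (P r) = c * (real_of_int (Q r) - a * real_of_int (P r))" for r
      using ab unfolding c_def[symmetric] by (simp add: algebra_simps)
    moreover have "\<bar>c\<bar> * (1 / T) \<le> 3.15"
      using b(6) b(5) eu e T unfolding c_def by (simp add: divide_simps)
    ultimately have "\<bar>real_of_int (Q r) * c - real_of_int (P r)\<bar> \<le> 3.15 / (eps t / 8) ^ r" for r
      using err[of c "3.15" r] by metis
    then have "\<bar>real_of_int p - c * real_of_int q\<bar> > 1 / (8.01 * T * (0.4 * T) powr kappa t * \<bar>real_of_int q\<bar> powr kappa t)"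
      by (intro measure_with_constants[OF t PQ(2) _ PQ(6) ql(2) B(2) C(1)])
    then show ?thesis using 3 unfolding cconst_def T_def c_def beta_def by simp
  next
    case 4
    have bet: "beta t j = - (1 + a) / (1 - a)"
      using 4 e b(4) a1 unfolding beta_def a_def by (simp add: divide_simps) (simp add: algebra_simps power2_eq_square)
    have "real_of_int (P r - Q r) * (- (1 + a) / (1 - a)) - real_of_int (- (P r + Q r)) = 2 / (1 - a) * (real_of_int (Q r) - a * real_of_int (P r))" for r
      using a1 by (simp add: divide_simps) (simp add: algebra_simps)
    moreover have "\<bar>2 / (1 - a)\<bar> * (1 / T) \<le> 3.15 / T"
      using a1 T by (simp add: divide_simps)
    ultimately have "\<bar>real_of_int (P r - Q r) * (- (1 + a) / (1 - a)) - real_of_int (- (P r + Q r))\<bar> \<le> 3.15 / T / (eps t / 8) ^ r" for r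
      using err[of "2 / (1 - a)" "3.15 / T" r] by metis
    moreover have "- (P r + Q r) * (P (Suc r) - Q (Suc r)) \<noteq> - (P (Suc r) + Q (Suc r)) * (P r - Q r)" for r
      using PQ(6)[of r] by (simp add: algebra_simps)
    ultimately have "\<bar>real_of_int p - (- (1 + a) / (1 - a)) * real_of_int q\<bar> > 1 / (11.33 * T * 0.4 powr kappa t * \<bar>real_of_int q\<bar> powr kappa t)"
      by (intro measure_with_constants[OF t PQ(4) _ _ ql(1) B(1) C(2), where a = "\<lambda>r. - (P r + Q r)"])
    then show ?thesis using 4 unfolding cconst_def T_def bet by simp
  qed
qed

end
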